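(* Let $d(n)$ be a sequence of positive integers with $d(n)-\log_2 n\to\infty$ as $n\to\infty$, and let $f_{n,d(n)}$ be uniformly chosen from $\mathrm{Hom}(P_{n,d(n)},0)$. Then $$\mathbb{P}(\Omega_0\cup\Omega_1)=\mathbb{P}\big(|\mathrm{Rng}(f_{n,d(n)})|\le 3\big)\xrightarrow[n\to\infty]{}1 \quad\text{and}\quad \mathbb{P}(\Omega_0\cap\Omega_1)=\mathbb{P}\big(|\mathrm{Rng}(f_{n,d(n)})|<3\big)\xrightarrow[n\to\infty]{}0.$$ Moreover, if $n$ tends to infinity through odd numbers then $\mathbb{P}(\Omega_0)\to 1/2$, and if $n$ tends to infinity through even numbers then $\mathbb{P}(\Omega_0)\to 1/3$.
   Context: For $n,d\ge 1$, $P_{n,d}$ is the graph with vertex set $\{0,1,\dots,n\}$ in which $i,j$ are adjacent iff $|i-j|\in\{1,3,\dots,2d+1\}$. $\mathrm{Hom}(P_{n,d},0)$ is the finite set of functions $f\colon\{0,\dots,n\}\to\mathbb{Z}$ with $f(0)=0$ and $|f(i)-f(j)|=1$ whenever $i,j$ are adjacent in $P_{n,d}$. $\mathrm{Rng}(f)$ denotes the set of values taken by $f$. $V_0$ and $V_1$ are the sets of even and odd vertices in $\{0,1,\dots,n\}$, respectively; $\Omega_0$ (resp. $\Omega_1$) is the set of homomorphisms in $\mathrm{Hom}(P_{n,d(n)},0)$ that are constant on $V_0$ (resp. on $V_1$). Probabilities of subsets of $\mathrm{Hom}(P_{n,d(n)},0)$ are with respect to the uniform distribution. *)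

theory Defs
  imports "HOL-Probability.Probability"
begin

definition P_vertices :: "nat \<Rightarrow> nat set" where
  "P_vertices n = {0..n}"

definition P_adj :: "nat \<Rightarrow> nat \<Rightarrow> nat \<Rightarrow> nat \<Rightarrow> bool" where
  "P_adj n d i j \<longleftrightarrow> i \<in> P_vertices n \<and> j \<in> P_vertices n \<and>
     \<bar>int i - int j\<bar> \<in> {2 * int k + 1 |k. k \<le> d}"

text \<open>Functions on the vertex set are taken extensional (value \<open>undefined\<close> outside
  \<open>{0..n}\<close>), so that distinct elements differ on a vertex and counting is correct.\<close>

definition Hom_P :: "nat \<Rightarrow> nat \<Rightarrow> (nat \<Rightarrow> int) set" where
  "Hom_P n d = {f \<in> P_vertices n \<rightarrow>\<^sub>E UNIV. f 0 = 0 \<and>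
     (\<forall>i j. P_adj n d i j \<longrightarrow> \<bar>f i - f j\<bar> = 1)}"

definition Rng :: "nat \<Rightarrow> (nat \<Rightarrow> int) \<Rightarrow> int set" where
  "Rng n f = f ` P_vertices n"

definition V0 :: "nat \<Rightarrow> nat set" where
  "V0 n = {i \<in> P_vertices n. even i}"

definition V1 :: "nat \<Rightarrow> nat set" where
  "V1 n = {i \<in> P_vertices n. odd i}"

definition Omega0 :: "nat \<Rightarrow> nat \<Rightarrow> (nat \<Rightarrow> int) set" where
  "Omega0 n d = {f \<in> Hom_P n d. f constant_on V0 n}"

definition Omega1 :: "nat \<Rightarrow> nat \<Rightarrow> (nat \<Rightarrow> int) set" where
  "Omega1 n d = {f \<in> Hom_P n d. f constant_on V1 n}"

text \<open>\<^const>\<open>pmf_of_set\<close> is the uniform distribution only on finite nonempty sets;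
  both conditions are verified below.\<close>

definition prob_P :: "nat \<Rightarrow> nat \<Rightarrow> (nat \<Rightarrow> int) set \<Rightarrow> real" where
  "prob_P n d A = measure_pmf.prob (pmf_of_set (Hom_P n d)) A"

lemma Hom_P_nonempty: "Hom_P n d \<noteq> {}"
proof -
  let ?f = "restrict (\<lambda>i. int (i mod 2)) (P_vertices n)"
  have "\<bar>?f i - ?f j\<bar> = 1" if "P_adj n d i j" for i j
  proof -
    from that obtain k :: nat where k: "\<bar>int i - int j\<bar> = 2 * int k + 1"
      and ij: "i \<in> P_vertices n" "j \<in> P_vertices n"
      unfolding P_adj_def by auto
    have "i mod 2 \<noteq> j mod 2" using k by presburger
    then have "\<bar>int (i mod 2) - int (j mod 2)\<bar> = 1" by linarith
    with ij show ?thesis by simp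
  qed
  then have "?f \<in> Hom_P n d"
    unfolding Hom_P_def by (auto simp: P_vertices_def)
  then show ?thesis by blast
qed

lemma finite_Hom_P: "finite (Hom_P n d)"
proof (rule finite_subset)
  show "Hom_P n d \<subseteq> P_vertices n \<rightarrow>\<^sub>E {- int n..int n}"
  proof
    fix f assume f: "f \<in> Hom_P n d"
    have step: "\<bar>f (Suc i) - f i\<bar> = 1" if "Suc i \<le> n" for i
    proof -
      have "P_adj n d (Suc i) i"
        unfolding P_adj_def P_vertices_def using that by (auto intro!: exI[of _ 0])
      with f show ?thesis unfolding Hom_P_def by blast
    qed
    have bound: "\<bar>f i\<bar> \<le> int i" if "i \<le> n" for i
      using that
    proof (induction i)
      case 0
      then show ?case using f by (simp add: Hom_P_def)
    next
      case (Suc i)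
      then show ?case using step[of i] by simp
    qed
    have "f i \<in> {- int n..int n}" if "i \<in> P_vertices n" for i
      using bound[of i] that unfolding P_vertices_def atLeastAtMost_iff by linarith
    moreover have "f \<in> extensional (P_vertices n)"
      using f by (simp add: Hom_P_def PiE_def)
    ultimately show "f \<in> P_vertices n \<rightarrow>\<^sub>E {- int n..int n}"
      by (simp add: PiE_def)
  qed
  show "finite (P_vertices n \<rightarrow>\<^sub>E {- int n..int n})"
    by (rule finite_PiE) (auto simp: P_vertices_def)
qed

end

theory Submission imports Defs
begin

text \<open>A homomorphism outside \<open>\<Omega>\<^sub>0 \<union> \<Omega>\<^sub>1\<close> must be 2-periodic on some window
  \<open>{p..p + 2 * d + 1}\<close>. It is then determined by its restriction to \<open>{0..p + 1}\<close> and its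
  translated restriction to \<open>{p + 2 * d..n}\<close>, two homomorphisms on paths of total length
  \<open>n + 1 - 2 * d\<close>. Induction on \<open>n\<close> then gives at most \<open>4 * sqrt 2 ^ n\<close> homomorphisms as
  long as \<open>32 * n \<le> 2 ^ d\<close>, and summing over the \<open>n\<close> possible windows, at most
  \<open>32 * n / 2 ^ d * sqrt 2 ^ n\<close> exceptional ones. This is negligible against
  \<open>|\<Omega>\<^sub>0| = 2 ^ ((n + 1) div 2)\<close> and \<open>|\<Omega>\<^sub>1| = 2 ^ (n div 2 + 1)\<close>.\<close>

section \<open>Homomorphisms in arithmetic form\<close>

text \<open>The distances 1, 3, ..., 2d+1 are exactly the odd numbers up to 2d+1, so adjacency
  splits into a parity condition and a distance bound, both suited to linear arithmetic.\<close>

lemma Hom_P_iff: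
  "f \<in> Hom_P n d \<longleftrightarrow> f \<in> extensional {0..n} \<and> f 0 = 0 \<and>
     (\<forall>i\<le>n. \<forall>j\<le>n. odd (i + j) \<longrightarrow> \<bar>int i - int j\<bar> \<le> 2 * int d + 1 \<longrightarrow> \<bar>f i - f j\<bar> = 1)"
proof -
  have "P_adj n d i j \<longleftrightarrow>
      i \<le> n \<and> j \<le> n \<and> odd (i + j) \<and> \<bar>int i - int j\<bar> \<le> 2 * int d + 1" for i j
  proof -
    have "\<bar>int i - int j\<bar> \<in> {2 * int k + 1 |k. k \<le> d} \<longleftrightarrow>
        odd (i + j) \<and> \<bar>int i - int j\<bar> \<le> 2 * int d + 1" (is "?l \<longleftrightarrow> ?r")
    proof
      assume ?l
      then obtain k where k: "\<bar>int i - int j\<bar> = 2 * int k + 1" "k \<le> d" by auto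
      have "odd (i + j)" using k(1) by presburger
      with k show ?r by simp
    next
      assume r: ?r
      then have "odd \<bar>int i - int j\<bar>" by presburger
      then obtain a where a: "\<bar>int i - int j\<bar> = 2 * a + 1" by (elim oddE)
      then have "a \<ge> 0" by linarith
      with a r show ?l by (intro CollectI exI[of _ "nat a"]) auto
    qed
    then show ?thesis by (simp add: P_adj_def P_vertices_def)
  qed
  then show ?thesis by (auto simp: Hom_P_def P_vertices_def PiE_def)
qed

lemma Hom_P_adj:
  assumes "f \<in> Hom_P n d" "i \<le> n" "j \<le> n" "odd (i + j)" "i \<le> j + 2 * d + 1" "j \<le> i + 2 * d + 1"
  shows "\<bar>f i - f j\<bar> = 1"
proof -
  have "\<bar>int i - int j\<bar> \<le> 2 * int d + 1" using assms(5,6) by linarith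
  with assms show ?thesis unfolding Hom_P_iff by blast
qed

lemma Hom_P_Suc:
  assumes "f \<in> Hom_P n d" "Suc i \<le> n"
  shows "\<bar>f (Suc i) - f i\<bar> = 1"
  using assms by (intro Hom_P_adj) auto

lemma Hom_P_zero: "f \<in> Hom_P n d \<Longrightarrow> f 0 = 0"
  by (simp add: Hom_P_iff)

text \<open>The value starts at 0 and changes by 1 between consecutive vertices. This keeps the
  values on even vertices apart from those on odd vertices.\<close>

lemma Hom_P_parity:
  assumes "f \<in> Hom_P n d" "i \<le> n"
  shows "even (f i) \<longleftrightarrow> even i"
  using assms(2)
proof (induction i)
  case 0
  then show ?case using Hom_P_zero[OF assms(1)] by simp
next
  case (Suc i)
  have "\<bar>f (Suc i) - f i\<bar> = 1" using Hom_P_Suc assms Suc by blast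
  then show ?case using Suc by simp presburger
qed

lemma Hom_P_eqI:
  assumes "f \<in> Hom_P n d" "g \<in> Hom_P n d" "\<And>i. i \<le> n \<Longrightarrow> f i = g i"
  shows "f = g"
  using assms by (intro extensionalityI[of _ "{0..n}"]) (auto simp: Hom_P_iff)

section \<open>The classes \<open>Omega0\<close>, \<open>Omega1\<close> and the size of the
  range\<close>

lemma Omega0_iff: "f \<in> Omega0 n d \<longleftrightarrow> f \<in> Hom_P n d \<and> (\<forall>i\<le>n. even i \<longrightarrow> f i = 0)"
proof (cases "f \<in> Hom_P n d")
  case True
  then have "f constant_on V0 n \<longleftrightarrow> (\<forall>i\<in>V0 n. f i = f 0)"
    unfolding constant_on_def V0_def P_vertices_def by (metis (mono_tags, lifting)
        atLeastAtMost_iff even_zero mem_Collect_eq order_refl zero_le)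
  with True show ?thesis by (auto simp: Omega0_def V0_def P_vertices_def Hom_P_zero)
qed (simp add: Omega0_def)

lemma Omega1_iff:
  assumes "n \<ge> 1"
  shows "f \<in> Omega1 n d \<longleftrightarrow> f \<in> Hom_P n d \<and> (\<forall>i\<le>n. odd i \<longrightarrow> f i = f 1)"
proof -
  have "1 \<in> V1 n" using assms by (simp add: V1_def P_vertices_def)
  then have "f constant_on V1 n \<longleftrightarrow> (\<forall>i\<in>V1 n. f i = f 1)"
    unfolding constant_on_def by metis
  then show ?thesis by (auto simp: Omega1_def V1_def P_vertices_def)
qed

text \<open>If one parity class has the constant value c, every vertex of the other class has a
  neighbour in it, so all values lie within 1 of c. If neither class is constant, there are two even
  and two odd values, hence at least four.\<close>

lemma Omega_Un_iff_card_Rng: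
  assumes n: "n \<ge> 1" and f: "f \<in> Hom_P n d"
  shows "f \<in> Omega0 n d \<union> Omega1 n d \<longleftrightarrow> card (Rng n f) \<le> 3"
proof
  assume "f \<in> Omega0 n d \<union> Omega1 n d"
  then have "\<exists>c. Rng n f \<subseteq> {c - 1, c, c + 1}"
  proof
    assume "f \<in> Omega0 n d"
    then have "f i \<in> {0 - 1, 0, 0 + 1}" if "i \<le> n" for i
      using that Hom_P_Suc[OF f, of "i - 1"] unfolding Omega0_iff
      by (cases "even i") (auto simp: odd_pos dest!: spec[of _ "i - 1"])
    then show ?thesis unfolding Rng_def P_vertices_def
      by (meson atLeastAtMost_iff image_subsetI)
  next
    assume "f \<in> Omega1 n d"
    then have odd: "\<And>i. i \<le> n \<Longrightarrow> odd i \<Longrightarrow> f i = f 1" using Omega1_iff n by blast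
    have "f i \<in> {f 1 - 1, f 1, f 1 + 1}" if "i \<le> n" for i
    proof (cases "odd i")
      case False
      show ?thesis
      proof (cases i)
        case 0
        then show ?thesis using Hom_P_Suc[OF f, of 0] n by auto
      next
        case (Suc k)
        with False that have "f k = f 1" by (intro odd) auto
        then show ?thesis using Hom_P_Suc[OF f, of k] Suc that by auto
      qed
    qed (use odd that in auto)
    then show ?thesis unfolding Rng_def P_vertices_def
      by (meson atLeastAtMost_iff image_subsetI)
  qed
  then obtain c where "Rng n f \<subseteq> {c - 1, c, c + 1}" by blast
  then have "card (Rng n f) \<le> card {c - 1, c, c + 1}" by (intro card_mono) auto
  then show "card (Rng n f) \<le> 3" by simp
next
  assume card: "card (Rng n f) \<le> 3"
  show "f \<in> Omega0 n d \<union> Omega1 n d"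
  proof (rule ccontr)
    assume "f \<notin> Omega0 n d \<union> Omega1 n d"
    then obtain u w where u: "u \<le> n" "even u" "f u \<noteq> 0" and w: "w \<le> n" "odd w" "f w \<noteq> f 1"
      using f Omega0_iff Omega1_iff[OF n] by blast
    have "even (f u)" "odd (f w)" "odd (f 1)"
      using u w n by (auto simp: Hom_P_parity[OF f])
    then have "f u \<noteq> f 1" "f u \<noteq> f w" "f 1 \<noteq> 0" "f w \<noteq> 0" by auto
    then have "card {0, f u, f 1, f w} = 4"
      using u(3) w(3) by (simp add: card_insert_if)
    moreover have "{0, f u, f 1, f w} \<subseteq> Rng n f"
      using u w n Hom_P_zero[OF f] unfolding Rng_def P_vertices_def by force
    ultimately have "4 \<le> card (Rng n f)"
      by (metis card_mono finite_imageI finite_atLeastAtMost Rng_def P_vertices_def)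
    with card show False by simp
  qed
qed

lemma Omega_Int_iff_card_Rng:
  assumes n: "n \<ge> 1" and f: "f \<in> Hom_P n d"
  shows "f \<in> Omega0 n d \<inter> Omega1 n d \<longleftrightarrow> card (Rng n f) < 3"
proof
  assume "f \<in> Omega0 n d \<inter> Omega1 n d"
  then have "f i \<in> {0, f 1}" if "i \<le> n" for i
    using that Omega0_iff Omega1_iff[OF n] by blast
  then have "Rng n f \<subseteq> {0, f 1}" unfolding Rng_def P_vertices_def
    by (meson atLeastAtMost_iff image_subsetI)
  then have "card (Rng n f) \<le> card {0, f 1}" by (intro card_mono) auto
  also have "\<dots> \<le> 2" by (simp add: card_insert_if)
  finally show "card (Rng n f) < 3" by simp
next
  assume card: "card (Rng n f) < 3"
  show "f \<in> Omega0 n d \<inter> Omega1 n d"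
  proof (rule ccontr)
    assume "f \<notin> Omega0 n d \<inter> Omega1 n d"
    then obtain u where u: "u \<le> n" "f u \<noteq> 0" "f u \<noteq> f 1"
    proof -
      \<comment> \<open>Some class is not constant, so some even u has \<open>f u\<close> different
        from 0, or some odd u has \<open>f u\<close> different from \<open>f 1\<close>; the other
        inequality is then a matter of parity.\<close>
      have "\<exists>u\<le>n. f u \<noteq> 0 \<and> f u \<noteq> f 1"
        using \<open>f \<notin> Omega0 n d \<inter> Omega1 n d\<close> f n Omega0_iff Omega1_iff[OF n]
          Hom_P_parity[OF f] by (metis IntI even_zero odd_one)
      then show ?thesis using that by blast
    qed
    have "odd (f 1)" using n by (simp add: Hom_P_parity[OF f])
    then have "card {0, f u, f 1} = 3"
      using u by (subst card_insert_disjoint; force)+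
    moreover have "{0, f u, f 1} \<subseteq> Rng n f"
      using u n Hom_P_zero[OF f] unfolding Rng_def P_vertices_def by force
    ultimately have "3 \<le> card (Rng n f)"
      by (metis card_mono finite_imageI finite_atLeastAtMost Rng_def P_vertices_def)
    with card show False by simp
  qed
qed

section \<open>Exact sizes of \<open>Omega0\<close> and \<open>Omega1\<close>, and a bound on their
  intersection\<close>

lemma card_even_atMost: "card {i \<in> {0..n::nat}. even i} = n div 2 + 1"
proof (induction n)
  case (Suc n)
  have "{i \<in> {0..Suc n}. even i} =
      (if even (Suc n) then insert (Suc n) {i \<in> {0..n}. even i} else {i \<in> {0..n}. even i})"
    by (auto simp: le_Suc_eq)
  then show ?case using Suc by (auto simp: card_insert_if)
qed (simp cong: conj_cong)

lemma card_odd_atMost: "card {i \<in> {0..n::nat}. odd i} = (n + 1) div 2"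
proof (induction n)
  case (Suc n)
  have "{i \<in> {0..Suc n}. odd i} =
      (if odd (Suc n) then insert (Suc n) {i \<in> {0..n}. odd i} else {i \<in> {0..n}. odd i})"
    by (auto simp: le_Suc_eq)
  then show ?case using Suc by (auto simp: card_insert_if)
qed (auto simp: card_eq_0_iff odd_pos)

text \<open>Such an f vanishes on even vertices, and every edge joins an even to an odd vertex.
  Hence the signs on the odd vertices can be chosen freely and independently.\<close>

lemma card_Omega0: "card (Omega0 n d) = 2 ^ ((n + 1) div 2)"
proof -
  let ?V = "{i \<in> {0..n}. odd i}"
  have "bij_betw (\<lambda>f. restrict f ?V) (Omega0 n d) (?V \<rightarrow>\<^sub>E {-1, 1 :: int})"
  proof (rule bij_betw_byWitness[where f' = "\<lambda>h. \<lambda>i\<in>{0..n}. if even i then 0 else h i"])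
    show "\<forall>f\<in>Omega0 n d. (\<lambda>i\<in>{0..n}. if even i then 0 else restrict f ?V i) = f"
      by (auto simp: Omega0_iff Hom_P_iff fun_eq_iff extensional_def)
    show "\<forall>h\<in>?V \<rightarrow>\<^sub>E {-1, 1}. restrict (\<lambda>i\<in>{0..n}. if even i then 0 else h i) ?V = h"
      by (auto simp: fun_eq_iff PiE_def extensional_def)
    have "f i \<in> {-1, 1}" if "f \<in> Omega0 n d" "i \<le> n" "odd i" for f i
    proof -
      have "f (i - 1) = 0" using that by (simp add: Omega0_iff)
      then show ?thesis
        using that Hom_P_Suc[of f n d "i - 1"] by (auto simp: Omega0_iff odd_pos)
    qed
    then show "(\<lambda>f. restrict f ?V) ` Omega0 n d \<subseteq> ?V \<rightarrow>\<^sub>E {-1, 1}"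
      by (intro image_subsetI restrict_PiE_iff[THEN iffD2]) auto
    show "(\<lambda>h. \<lambda>i\<in>{0..n}. if even i then 0 else h i) ` (?V \<rightarrow>\<^sub>E {-1, 1}) \<subseteq> Omega0 n d"
    proof (intro image_subsetI)
      fix h :: "nat \<Rightarrow> int" assume "h \<in> ?V \<rightarrow>\<^sub>E {-1, 1}"
      then have "\<bar>h i\<bar> = 1" if "i \<le> n" "odd i" for i using that by (force dest: PiE_mem)
      then show "(\<lambda>i\<in>{0..n}. if even i then 0 else h i) \<in> Omega0 n d"
        by (auto simp: Omega0_iff Hom_P_iff)
    qed
  qed
  then have "card (Omega0 n d) = card (?V \<rightarrow>\<^sub>E {-1, 1 :: int})" by (rule bij_betw_same_card)
  also have "\<dots> = (\<Prod>i\<in>?V. 2)" by (simp add: card_PiE numeral_2_eq_2)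
  also have "\<dots> = 2 ^ ((n + 1) div 2)" by (simp only: prod_constant card_odd_atMost)
  finally show ?thesis .
qed

text \<open>The common odd value \<open>f 1\<close> is a free sign, and each even vertex other than
  0 lies freely at \<open>f 1\<close> plus or minus 1.\<close>

lemma card_Omega1:
  assumes n: "n \<ge> 1"
  shows "card (Omega1 n d) = 2 ^ (n div 2 + 1)"
proof -
  let ?V = "{i \<in> {0..n}. even i}"
  \<comment> \<open>The value at vertex 0 is forced, so the coordinate at 0 is reused to store the
    sign \<open>f 1\<close>. This makes the code a sign vector indexed by all even vertices.\<close>
  let ?F = "\<lambda>f :: nat \<Rightarrow> int. \<lambda>i\<in>?V. if i = 0 then f 1 else f i - f 1"
  let ?G = "\<lambda>h :: nat \<Rightarrow> int. \<lambda>i\<in>{0..n}. if odd i then h 0 else if i = 0 then 0 else h 0 + h i"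
  have "bij_betw ?F (Omega1 n d) (?V \<rightarrow>\<^sub>E {-1, 1 :: int})"
  proof (rule bij_betw_byWitness[where f' = ?G])
    show "\<forall>f\<in>Omega1 n d. ?G (?F f) = f"
    proof (intro ballI ext)
      fix f i assume f: "f \<in> Omega1 n d"
      then have hom: "f \<in> Hom_P n d" using Omega1_def by auto
      consider "i > n" | "i \<le> n" "odd i" | "i = 0" | "i \<le> n" "even i" "i \<noteq> 0" by fastforce
      then show "?G (?F f) i = f i"
      proof cases
        case 2
        then have "f i = f 1" using f Omega1_iff[OF n] by blast
        with 2 show ?thesis by simp
      qed (use hom in \<open>auto simp: Hom_P_iff extensional_def\<close>)
    qed
    show "\<forall>h\<in>?V \<rightarrow>\<^sub>E {-1, 1}. ?F (?G h) = h"
      using n by (auto simp: fun_eq_iff PiE_def extensional_def)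
    have "?F f i \<in> {-1, 1}" if f: "f \<in> Omega1 n d" and i: "i \<le> n" "even i" for f i
    proof (cases i)
      case 0
      then show ?thesis using f n Hom_P_Suc[of f n d 0] Hom_P_zero[of f n d]
        by (auto simp: Omega1_def)
    next
      case (Suc k)
      have hom: "f \<in> Hom_P n d" using f Omega1_def by auto
      have "k \<le> n" "odd k" using i Suc by auto
      then have "f k = f 1" using f Omega1_iff[OF n] by blast
      then show ?thesis using i Suc Hom_P_Suc[OF hom, of k] by auto
    qed
    then show "?F ` Omega1 n d \<subseteq> ?V \<rightarrow>\<^sub>E {-1, 1}"
      by (intro image_subsetI PiE_I) auto
    show "?G ` (?V \<rightarrow>\<^sub>E {-1, 1}) \<subseteq> Omega1 n d"
    proof (intro image_subsetI)
      fix h :: "nat \<Rightarrow> int" assume "h \<in> ?V \<rightarrow>\<^sub>E {-1, 1}"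
      then have "\<bar>h i\<bar> = 1" if "i \<le> n" "even i" for i using that by (force dest: PiE_mem)
      then show "?G h \<in> Omega1 n d"
        using n by (auto simp: Omega1_iff[OF n] Hom_P_iff)
    qed
  qed
  then have "card (Omega1 n d) = card (?V \<rightarrow>\<^sub>E {-1, 1 :: int})" by (rule bij_betw_same_card)
  also have "\<dots> = (\<Prod>i\<in>?V. 2)" by (simp add: card_PiE numeral_2_eq_2)
  also have "\<dots> = 2 ^ (n div 2 + 1)" by (simp only: prod_constant card_even_atMost)
  finally show ?thesis .
qed

text \<open>A function constant on both classes is determined by \<open>f 1\<close>, which is 1 or
  -1.\<close>

lemma card_Omega_Int_le:
  assumes n: "n \<ge> 1"
  shows "card (Omega0 n d \<inter> Omega1 n d) \<le> 2"
proof -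
  have "card (Omega0 n d \<inter> Omega1 n d) \<le> card {-1, 1 :: int}"
  proof (rule card_inj_on_le)
    show "inj_on (\<lambda>f. f 1) (Omega0 n d \<inter> Omega1 n d)"
    proof (rule inj_onI)
      fix f g assume fg: "f \<in> Omega0 n d \<inter> Omega1 n d" "g \<in> Omega0 n d \<inter> Omega1 n d" "f 1 = g 1"
      then have "f i = g i" if "i \<le> n" for i
        using that Omega0_iff Omega1_iff[OF n] by (metis IntE)
      then show "f = g" using fg by (intro Hom_P_eqI) (auto simp: Omega0_iff)
    qed
    show "(\<lambda>f. f 1) ` (Omega0 n d \<inter> Omega1 n d) \<subseteq> {-1, 1}"
    proof (intro image_subsetI)
      fix f assume "f \<in> Omega0 n d \<inter> Omega1 n d"
      then have "f \<in> Hom_P n d" by (simp add: Omega0_iff)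
      from Hom_P_Suc[OF this, of 0] Hom_P_zero[OF this] n show "f 1 \<in> {-1, 1}" by auto
    qed
  qed simp
  then show ?thesis by simp
qed

section \<open>Covering the exceptional homomorphisms by periodic windows\<close>

text \<open>The last condition, at v = p+2d-1, reaches the vertex p+2d+1. The window thus has 2d+2
  vertices, and f takes a single value on each of its parity classes.\<close>

definition periodic_on_window :: "nat \<Rightarrow> nat \<Rightarrow> nat \<Rightarrow> (nat \<Rightarrow> int) set" where
  "periodic_on_window n d p = {f \<in> Hom_P n d. \<forall>v\<in>{p..<p + 2 * d}. f (v + 2) = f v}"

lemma Hom_P_restrict:
  assumes "f \<in> Hom_P n d" "m \<le> n"
  shows "restrict f {0..m} \<in> Hom_P m d"
  using assms by (auto simp: Hom_P_iff)

text \<open>Adjacency is translation invariant, and subtracting \<open>f q\<close> restores the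
  normalization at 0.\<close>

lemma Hom_P_shift:
  assumes "f \<in> Hom_P n d" "q \<le> n"
  shows "(\<lambda>i\<in>{0..n - q}. f (q + i) - f q) \<in> Hom_P (n - q) d"
  using assms by (auto simp: Hom_P_iff)

lemma card_periodic_on_window_le:
  assumes p: "p + 2 * d + 2 \<le> n"
  shows "card (periodic_on_window n d p) \<le> card (Hom_P (p + 1) d) * card (Hom_P (n - (p + 2 * d)) d)"
proof -
  let ?q = "p + 2 * d"
  let ?F = "\<lambda>f :: nat \<Rightarrow> int. (restrict f {0..p + 1}, \<lambda>i\<in>{0..n - ?q}. f (?q + i) - f ?q)"
  have "card (periodic_on_window n d p) \<le> card (Hom_P (p + 1) d \<times> Hom_P (n - ?q) d)"
  proof (rule card_inj_on_le)
    show "inj_on ?F (periodic_on_window n d p)"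
    proof (rule inj_onI)
      fix f g assume f: "f \<in> periodic_on_window n d p" and g: "g \<in> periodic_on_window n d p"
        and eq: "?F f = ?F g"
      have left: "f i = g i" if "i \<le> p + 1" for i
        using eq that by (auto simp: restrict_def fun_eq_iff split: if_splits)
      \<comment> \<open>Periodicity propagates agreement from p and p+1 in steps of two up to
        p+2d+1.\<close>
      have window: "f i = g i" if "i \<le> ?q + 1" for i
        using that
      proof (induction i rule: less_induct)
        case (less i)
        show ?case
        proof (cases "i \<le> p + 1")
          case False
          then have "i - 2 \<in> {p..<?q}" using less.prems by auto
          then have "f (i - 2 + 2) = f (i - 2)" "g (i - 2 + 2) = g (i - 2)"
            using f g unfolding periodic_on_window_def by blast+
          moreover have "f (i - 2) = g (i - 2)" using less False by auto
          moreover have "i - 2 + 2 = i" using False by simp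
          ultimately show ?thesis by metis
        qed (use left in blast)
      qed
      have right: "f (?q + j) - f ?q = g (?q + j) - g ?q" if "j \<le> n - ?q" for j
        using eq that by (auto dest!: fun_cong[of _ _ j])
      \<comment> \<open>The translated piece only records differences from the value at p+2d; that
        value lies in the window and is already known to agree.\<close>
      have "f i = g i" if "i \<le> n" for i
        using window[of i] window[of ?q] right[of "i - ?q"] that by (cases "i \<le> ?q") auto
      then show "f = g" using f g unfolding periodic_on_window_def by (blast intro: Hom_P_eqI)
    qed
    show "?F ` periodic_on_window n d p \<subseteq> Hom_P (p + 1) d \<times> Hom_P (n - ?q) d"
      using p unfolding periodic_on_window_def
      by (auto intro!: Hom_P_restrict[of _ n] Hom_P_shift simp del: One_nat_def add_Suc_right)
  qed (simp add: finite_Hom_P)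
  then show ?thesis by (simp add: card_cartesian_product)
qed

text \<open>Let \<open>m\<close> be the first vertex up to which both parity classes have become non-constant. All
  vertices of the other parity within distance \<open>2 * d + 1\<close> of \<open>m\<close> are adjacent both to \<open>m\<close>
  and to an earlier vertex of its class, hence have the value midway between.\<close>

lemma Hom_P_cover:
  assumes n: "n \<ge> 1" and f: "f \<in> Hom_P n d" and bad: "f \<notin> Omega0 n d \<union> Omega1 n d"
  obtains p where "p + 2 * d + 2 \<le> n" "f \<in> periodic_on_window n d p"
proof -
  define Q where "Q m \<longleftrightarrow> (\<exists>u\<le>m. \<exists>v\<le>m. even u \<and> even v \<and> f u \<noteq> f v) \<and>
    (\<exists>u\<le>m. \<exists>v\<le>m. odd u \<and> odd v \<and> f u \<noteq> f v)" for m
  obtain u w where u: "u \<le> n" "even u" "f u \<noteq> 0" and w: "w \<le> n" "odd w" "f w \<noteq> f 1"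
    using bad f Omega0_iff Omega1_iff[OF n] by blast
  have "Q n" unfolding Q_def using u w n Hom_P_zero[OF f]
    by (metis even_zero le0 odd_one)
  define m where "m = (LEAST m. Q m)"
  have Qm: "Q m" unfolding m_def by (rule LeastI) fact
  have mn: "m \<le> n" unfolding m_def by (rule Least_le) fact
  have "\<not> Q 0" unfolding Q_def by simp
  then have m0: "m > 0" using Qm by (cases m) auto
  have nQ: "\<not> Q (m - 1)" using not_less_Least[of "m - 1" Q] m0 unfolding m_def by simp
  \<comment> \<open>The vertex m cannot affect the class of opposite parity, so that class is
    already non-constant below m. By minimality of m, the class of m itself must still be constant
    strictly below m.\<close>
  have same: "f a = f b" if "a < m" "b < m" "even (a + m)" "even (b + m)" for a b
  proof (rule ccontr)
    assume ne: "f a \<noteq> f b"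
    have le: "a \<le> m - 1" "b \<le> m - 1" using that by auto
    show False
    proof (cases "even m")
      case True
      then have "\<exists>u\<le>m - 1. \<exists>v\<le>m - 1. odd u \<and> odd v \<and> f u \<noteq> f v"
        using Qm m0 unfolding Q_def by (metis One_nat_def Suc_pred le_Suc_eq)
      moreover have "even a" "even b" using that True by auto
      ultimately show False using nQ ne le unfolding Q_def by blast
    next
      case False
      then have "\<exists>u\<le>m - 1. \<exists>v\<le>m - 1. even u \<and> even v \<and> f u \<noteq> f v"
        using Qm m0 unfolding Q_def by (metis One_nat_def Suc_pred le_Suc_eq)
      moreover have "odd a" "odd b" using that False by auto
      ultimately show False using nQ ne le unfolding Q_def by blast
    qed
  qed
  \<comment> \<open>Otherwise the class of m would remain constant up to m, contrary to
    \<open>Q m\<close>.\<close>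
  have jump: "f m \<noteq> f a" if "a < m" "even (a + m)" for a
  proof
    assume eq: "f m = f a"
    have const: "f b = f c" if "b \<le> m" "c \<le> m" "even (b + m)" "even (c + m)" for b c
      using same[of b a] same[of c a] eq that \<open>a < m\<close> \<open>even (a + m)\<close>
      by (cases "b = m"; cases "c = m") auto
    obtain b c where "b \<le> m" "c \<le> m" "even (b + m)" "even (c + m)" "f b \<noteq> f c"
      using Qm unfolding Q_def by (cases "even m") (meson even_add)+
    with const show False by blast
  qed
  obtain a b where ab: "a < m" "b < m" "odd (a + m)" "odd (b + m)" "f a \<noteq> f b"
    using Qm unfolding Q_def by (cases "even m") (metis even_add le_neq_implies_less)+
  have m2: "m \<ge> 2"
  proof (rule ccontr)
    assume "\<not> m \<ge> 2"
    then have "a = b" using ab by auto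
    with ab show False by simp
  qed
  \<comment> \<open>The neighbour v' of v carries the common earlier value \<open>f (m - 2)\<close>.
    Both this value and the different value \<open>f m\<close> lie at distance 1 from
    \<open>f v\<close>, so \<open>f v\<close> is their midpoint.\<close>
  have mid: "2 * f v = f m + f (m - 2)" if "v < m" "odd (v + m)" "m \<le> v + 2 * d + 1" for v
  proof -
    have "\<exists>v'<m. even (v' + m) \<and> \<bar>f v' - f v\<bar> = 1"
    proof (cases "v + 1 < m")
      case True
      then show ?thesis using that mn Hom_P_Suc[OF f, of v] by (intro exI[of _ "v + 1"]) auto
    next
      case False
      then have "v - 1 < m" "Suc (v - 1) = v" using that m2 by auto
      then show ?thesis using that mn Hom_P_Suc[OF f, of "v - 1"] by (intro exI[of _ "v - 1"]) auto
    qed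
    then obtain v' where v': "v' < m" "even (v' + m)" "\<bar>f v' - f v\<bar> = 1" by blast
    have "f v' = f (m - 2)" using v' m2 by (intro same) auto
    moreover have "f m \<noteq> f v'" using v' by (intro jump)
    moreover have "\<bar>f m - f v\<bar> = 1" using that mn by (intro Hom_P_adj[OF f]) auto
    ultimately show ?thesis using v' by linarith
  qed
  \<comment> \<open>For smaller m, every earlier vertex of opposite parity is adjacent to m and
    takes the midpoint value, which contradicts the choice of a and b.\<close>
  have large: "m \<ge> 2 * d + 2"
  proof (rule ccontr)
    assume "\<not> m \<ge> 2 * d + 2"
    then have "2 * f a = 2 * f b" using mid[of a] mid[of b] ab by simp
    with ab show False by simp
  qed
  define p where "p = m - (2 * d + 2)"
  have mp: "m = p + 2 * d + 2" using large unfolding p_def by simp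
  have "f (v + 2) = f v" if "v \<in> {p..<p + 2 * d}" for v
  proof (cases "even (v + m)")
    case True
    then show ?thesis using that mp by (intro same) auto
  next
    case False
    \<comment> \<open>The distance from p to m is 2d+2, just too large for \<open>mid\<close>, but p
      has the parity of m. In this case v is therefore at least p+1, and \<open>mid\<close> applies
      to both v and v+2.\<close>
    then have "v \<noteq> p" using mp by auto
    with False have "2 * f (v + 2) = 2 * f v" using that mp by (subst (1 2) mid) auto
    then show ?thesis by simp
  qed
  then have "f \<in> periodic_on_window n d p" using f unfolding periodic_on_window_def by blast
  then show ?thesis using that mp mn by blast
qed

lemma card_Hom_P_le_sum:
  assumes n: "n \<ge> 1"
  shows "card (Hom_P n d - (Omega0 n d \<union> Omega1 n d)) \<le>
    (\<Sum>p | p + 2 * d + 2 \<le> n. card (Hom_P (p + 1) d) * card (Hom_P (n - (p + 2 * d)) d))"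
proof -
  let ?I = "{p. p + 2 * d + 2 \<le> n}"
  have fin: "finite ?I" by (rule finite_subset[of _ "{..n}"]) auto
  have "card (Hom_P n d - (Omega0 n d \<union> Omega1 n d)) \<le> card (\<Union>p\<in>?I. periodic_on_window n d p)"
  proof (rule card_mono)
    show "finite (\<Union>p\<in>?I. periodic_on_window n d p)"
      by (rule finite_subset[OF _ finite_Hom_P[of n d]]) (auto simp: periodic_on_window_def)
    show "Hom_P n d - (Omega0 n d \<union> Omega1 n d) \<subseteq> (\<Union>p\<in>?I. periodic_on_window n d p)"
      using Hom_P_cover[OF n] by blast
  qed
  also have "\<dots> \<le> (\<Sum>p\<in>?I. card (periodic_on_window n d p))"
    by (rule card_UN_le[OF fin])
  also have "\<dots> \<le> (\<Sum>p\<in>?I. card (Hom_P (p + 1) d) * card (Hom_P (n - (p + 2 * d)) d))"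
    by (intro sum_mono card_periodic_on_window_le) simp
  finally show ?thesis .
qed

section \<open>Exponential bounds and the induction on n\<close>

lemma sqrt2_power_le: "sqrt 2 ^ n \<le> (2::real) ^ ((n + 1) div 2)"
proof -
  have "sqrt 2 ^ n \<le> sqrt 2 ^ (2 * ((n + 1) div 2))"
    by (rule power_increasing) auto
  then show ?thesis by (simp add: power_mult)
qed

text \<open>Equality holds for n = 2k; for n = 2k+1 the left side is 4 times 2^k, and the claim
  reduces to 4/3 being at most sqrt 2.\<close>

lemma two_powers_le: "(2::real) ^ ((n + 1) div 2) + 2 ^ (n div 2 + 1) \<le> 3 * sqrt 2 ^ n"
proof (cases "even n")
  case True
  then obtain k where "n = 2 * k" by (elim evenE)
  then show ?thesis by (simp add: power_mult)
next
  case False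
  then obtain k where "n = 2 * k + 1" by (elim oddE)
  moreover have "4 / 3 \<le> sqrt (2::real)" by (rule real_le_rsqrt) (simp add: power2_eq_square)
  ultimately show ?thesis by (simp add: power_mult)
qed

text \<open>The bound on smaller paths is a hypothesis, so the estimate serves both inside the
  induction for \<open>card_Hom_P_le\<close> and after it.\<close>

lemma card_Hom_P_minus_Omega_le_step:
  assumes n: "n \<ge> 1" and d: "d \<ge> 1"
    and IH: "\<And>m. m < n \<Longrightarrow> real (card (Hom_P m d)) \<le> 4 * sqrt 2 ^ m"
  shows "real (card (Hom_P n d - (Omega0 n d \<union> Omega1 n d))) \<le> 32 * real n / 2 ^ d * sqrt 2 ^ n"
proof -
  let ?I = "{p. p + 2 * d + 2 \<le> n}"
  have I: "?I \<subseteq> {..<n}" by auto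
  have "real (card (Hom_P n d - (Omega0 n d \<union> Omega1 n d))) \<le>
      (\<Sum>p\<in>?I. real (card (Hom_P (p + 1) d)) * real (card (Hom_P (n - (p + 2 * d)) d)))"
    using card_Hom_P_le_sum[OF n, of d]
    by (metis (mono_tags, lifting) of_nat_le_iff of_nat_mult of_nat_sum sum.cong)
  also have "\<dots> \<le> (\<Sum>p\<in>?I. 32 / 2 ^ d * sqrt 2 ^ n)"
  proof (rule sum_mono)
    fix p assume p: "p \<in> ?I"
    have "real (card (Hom_P (p + 1) d)) * real (card (Hom_P (n - (p + 2 * d)) d))
        \<le> (4 * sqrt 2 ^ (p + 1)) * (4 * sqrt 2 ^ (n - (p + 2 * d)))"
      \<comment> \<open>Both pieces are shorter than n: p+1 because p+2d+2 is at most n, and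
        n-(p+2d) because d is at least 1.\<close>
      using p d by (intro mult_mono IH) auto
    also have "\<dots> = 16 * sqrt 2 ^ (p + 1 + (n - (p + 2 * d)))"
      by (simp add: power_add)
    also have "p + 1 + (n - (p + 2 * d)) = n + 1 - 2 * d" using p by auto
    \<comment> \<open>Dropping 2d from the exponent is the gain of 2^d; the extra sqrt 2 is then
      rounded up to 2, which turns 16 into 32.\<close>
    also have "16 * sqrt 2 ^ (n + 1 - 2 * d) = 16 * sqrt 2 * (sqrt 2 ^ n / 2 ^ d)"
    proof -
      have "sqrt 2 ^ (n + 1 - 2 * d) * sqrt 2 ^ (2 * d) = sqrt 2 ^ (n + 1)"
        using p by (simp flip: power_add)
      moreover have "sqrt 2 ^ (2 * d) = (2::real) ^ d" by (simp add: power_mult)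
      ultimately show ?thesis by (simp add: field_simps)
    qed
    also have "\<dots> \<le> 32 * (sqrt 2 ^ n / 2 ^ d)"
    proof (rule mult_right_mono)
      have "sqrt 2 \<le> 2" by (rule real_le_lsqrt) auto
      then show "16 * sqrt 2 \<le> 32" by simp
    qed simp
    finally show "real (card (Hom_P (p + 1) d)) * real (card (Hom_P (n - (p + 2 * d)) d))
        \<le> 32 / 2 ^ d * sqrt 2 ^ n" by simp
  qed
  also have "\<dots> = real (card ?I) * (32 / 2 ^ d * sqrt 2 ^ n)" by simp
  also have "\<dots> \<le> real n * (32 / 2 ^ d * sqrt 2 ^ n)"
    using card_mono[OF _ I] by (intro mult_right_mono) auto
  finally show ?thesis by (simp add: mult_ac)
qed

lemma Omega_subset: "Omega0 n d \<subseteq> Hom_P n d" "Omega1 n d \<subseteq> Hom_P n d"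
  unfolding Omega0_def Omega1_def by auto

lemma card_Hom_P_decomp:
  "card (Hom_P n d) + card (Omega0 n d \<inter> Omega1 n d) =
    card (Omega0 n d) + card (Omega1 n d) + card (Hom_P n d - (Omega0 n d \<union> Omega1 n d))"
proof -
  have fin: "finite (Omega0 n d)" "finite (Omega1 n d)"
    using Omega_subset finite_Hom_P finite_subset by metis+
  have "card (Hom_P n d) = card (Hom_P n d - (Omega0 n d \<union> Omega1 n d)) + card (Omega0 n d \<union> Omega1 n d)"
    using Omega_subset[of n d] fin card_mono[OF finite_Hom_P, of "Omega0 n d \<union> Omega1 n d" n d]
    by (subst card_Diff_subset) auto
  with card_Un_Int[OF fin] show ?thesis by simp
qed

text \<open>The constant 4 is 3 + 1: \<open>Omega0\<close> and \<open>Omega1\<close> together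
  contribute at most 3 times sqrt 2 ^ n, and the smallness of 32n/2^d limits the exceptional ones to
  one more such term. With d fixed, this smallness passes to all shorter paths.\<close>

lemma card_Hom_P_le:
  assumes "d \<ge> 1" "32 * real n \<le> 2 ^ d"
  shows "real (card (Hom_P n d)) \<le> 4 * sqrt 2 ^ n"
  using assms(2)
proof (induction n rule: less_induct)
  case (less n)
  show ?case
  proof (cases "n = 0")
    case True
    have "Hom_P 0 d \<subseteq> {\<lambda>i\<in>{0..0}. 0}" by (auto simp: Hom_P_iff fun_eq_iff extensional_def)
    from card_mono[OF _ this] True show ?thesis by simp
  next
    case False
    then have n: "n \<ge> 1" by simp
    have "real (card (Hom_P n d - (Omega0 n d \<union> Omega1 n d))) \<le> 32 * real n / 2 ^ d * sqrt 2 ^ n"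
      using less by (intro card_Hom_P_minus_Omega_le_step n assms(1)) auto
    also have "\<dots> \<le> 1 * sqrt 2 ^ n"
      using less.prems by (intro mult_right_mono) auto
    finally have "real (card (Hom_P n d - (Omega0 n d \<union> Omega1 n d))) \<le> sqrt 2 ^ n" by simp
    moreover have "real (card (Hom_P n d)) + real (card (Omega0 n d \<inter> Omega1 n d)) =
      real (card (Omega0 n d)) + real (card (Omega1 n d))
        + real (card (Hom_P n d - (Omega0 n d \<union> Omega1 n d)))"
      using arg_cong[OF card_Hom_P_decomp[of n d], of real] by simp
    ultimately show ?thesis
      using two_powers_le[of n] by (simp add: card_Omega0 card_Omega1[OF n])
  qed
qed

lemma card_Hom_P_minus_Omega_le:
  assumes "n \<ge> 1" "d \<ge> 1" "32 * real n \<le> 2 ^ d"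
  shows "real (card (Hom_P n d - (Omega0 n d \<union> Omega1 n d))) \<le> 32 * real n / 2 ^ d * sqrt 2 ^ n"
  using assms by (intro card_Hom_P_minus_Omega_le_step card_Hom_P_le) auto

section \<open>Probabilities as ratios of cardinalities\<close>

lemma prob_P_eq:
  assumes "A \<subseteq> Hom_P n d"
  shows "prob_P n d A = real (card A) / real (card (Hom_P n d))"
  using assms unfolding prob_P_def
  by (simp add: measure_pmf_of_set Hom_P_nonempty finite_Hom_P Int_absorb1)

lemma card_Omega0_pos: "card (Omega0 n d) > 0"
  by (simp add: card_Omega0)

lemma card_Omega0_ge: "sqrt 2 ^ n \<le> real (card (Omega0 n d))"
  using sqrt2_power_le by (simp add: card_Omega0)

text \<open>The total count is replaced by its subset \<open>Omega0\<close>, whose size is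
  explicit.\<close>

lemma prob_P_le_card_div_Omega0:
  assumes "A \<subseteq> Hom_P n d"
  shows "prob_P n d A \<le> real (card A) / real (card (Omega0 n d))"
proof -
  have "card (Omega0 n d) \<le> card (Hom_P n d)"
    by (rule card_mono[OF finite_Hom_P Omega_subset(1)])
  then show ?thesis
    using card_Omega0_pos[of n d] unfolding prob_P_eq[OF assms] by (intro divide_left_mono) auto
qed

text \<open>Inclusion-exclusion divided by the size of \<open>Omega0\<close>. The last bracket
  collects the exceptional and overlap terms, both of which tend to 0 under the growth assumption on
  d.\<close>

lemma prob_P_Omega0_eq:
  "prob_P n d (Omega0 n d) = 1 / (1 + real (card (Omega1 n d)) / real (card (Omega0 n d))
     + (real (card (Hom_P n d - (Omega0 n d \<union> Omega1 n d))) / real (card (Omega0 n d))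
     - real (card (Omega0 n d \<inter> Omega1 n d)) / real (card (Omega0 n d))))"
proof -
  have "real (card (Hom_P n d)) = real (card (Omega0 n d)) + real (card (Omega1 n d))
      + real (card (Hom_P n d - (Omega0 n d \<union> Omega1 n d))) - real (card (Omega0 n d \<inter> Omega1 n d))"
    using arg_cong[OF card_Hom_P_decomp[of n d], of real] by simp
  then have "1 + real (card (Omega1 n d)) / real (card (Omega0 n d))
     + (real (card (Hom_P n d - (Omega0 n d \<union> Omega1 n d))) / real (card (Omega0 n d))
     - real (card (Omega0 n d \<inter> Omega1 n d)) / real (card (Omega0 n d)))
     = real (card (Hom_P n d)) / real (card (Omega0 n d))"
    using card_Omega0_pos[of n d] by (simp add: diff_divide_distrib add_divide_distrib)
  then show ?thesis by (simp add: prob_P_eq[OF Omega_subset(1)])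
qed

section \<open>Limits and the final statement\<close>

text \<open>For positive n, n/2^d equals 2 to the power -(d - log 2 n), so the growth hypothesis
  makes it vanish.\<close>

lemma tendsto_linear_over_exp_zero:
  assumes "filterlim (\<lambda>n. real (d n) - log 2 (real n)) at_top sequentially"
  shows "(\<lambda>n. C * real n / 2 ^ d n) \<longlonglongrightarrow> 0"
proof -
  have "filterlim (\<lambda>n. - (real (d n) - log 2 (real n))) at_bot sequentially"
    using assms by (simp add: filterlim_uminus_at_top)
  then have "(\<lambda>n. exp (ln 2 * - (real (d n) - log 2 (real n)))) \<longlonglongrightarrow> 0"
    by (intro filterlim_compose[OF exp_at_bot] filterlim_tendsto_pos_mult_at_bot[OF tendsto_const]) auto
  then have "(\<lambda>n. C * exp (ln 2 * - (real (d n) - log 2 (real n)))) \<longlonglongrightarrow> 0"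
    by (rule tendsto_mult_right_zero)
  moreover have "\<forall>\<^sub>F n in sequentially.
      C * exp (ln 2 * - (real (d n) - log 2 (real n))) = C * real n / 2 ^ d n"
    using eventually_ge_at_top[of 1]
  proof eventually_elim
    case (elim n)
    have "exp (ln 2 * - (real (d n) - log 2 (real n))) = 2 powr (log 2 (real n) - real (d n))"
      by (simp add: powr_def)
    also have "\<dots> = real n / 2 ^ d n"
      using elim by (simp add: powr_diff powr_realpow)
    finally show ?case by simp
  qed
  ultimately show ?thesis by (rule Lim_transform_eventually)
qed

lemma card_Hom_P_minus_Omega_tendsto:
  assumes d_pos: "\<And>n. n \<ge> 1 \<Longrightarrow> d n \<ge> 1"
    and d_lim: "filterlim (\<lambda>n. real (d n) - log 2 (real n)) at_top sequentially"
  shows "(\<lambda>n. real (card (Hom_P n (d n) - (Omega0 n (d n) \<union> Omega1 n (d n))))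
    / real (card (Omega0 n (d n)))) \<longlonglongrightarrow> 0"
proof (rule tendsto_sandwich[OF _ _ tendsto_const tendsto_linear_over_exp_zero[OF d_lim]])
  \<comment> \<open>The same null sequence is the error bound and, once below 1, supplies the
    precondition of the counting estimate.\<close>
  have "\<forall>\<^sub>F n in sequentially. 32 * real n / 2 ^ d n < 1"
    using tendsto_linear_over_exp_zero[OF d_lim] by (rule order_tendstoD) simp
  then show "\<forall>\<^sub>F n in sequentially. real (card (Hom_P n (d n) - (Omega0 n (d n) \<union> Omega1 n (d n))))
      / real (card (Omega0 n (d n))) \<le> 32 * real n / 2 ^ d n"
    using eventually_ge_at_top[of 1]
  proof eventually_elim
    case (elim n)
    then have "32 * real n \<le> 2 ^ d n" by (simp add: field_simps)
    then have "real (card (Hom_P n (d n) - (Omega0 n (d n) \<union> Omega1 n (d n))))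
        \<le> 32 * real n / 2 ^ d n * sqrt 2 ^ n"
      using elim d_pos by (intro card_Hom_P_minus_Omega_le) auto
    also have "\<dots> \<le> 32 * real n / 2 ^ d n * real (card (Omega0 n (d n)))"
      by (intro mult_left_mono card_Omega0_ge) auto
    finally show ?case using card_Omega0_pos[of n "d n"] by (subst pos_divide_le_eq) auto
  qed
qed simp

lemma card_Omega_Int_tendsto:
  "(\<lambda>n. real (card (Omega0 n (d n) \<inter> Omega1 n (d n))) / real (card (Omega0 n (d n)))) \<longlonglongrightarrow> 0"
proof (rule tendsto_sandwich[OF _ _ tendsto_const])
  show "\<forall>\<^sub>F n in sequentially.
      real (card (Omega0 n (d n) \<inter> Omega1 n (d n))) / real (card (Omega0 n (d n))) \<le> 2 * (1 / sqrt 2) ^ n"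
    using eventually_ge_at_top[of 1]
  proof eventually_elim
    case (elim n)
    have "real (card (Omega0 n (d n) \<inter> Omega1 n (d n))) / real (card (Omega0 n (d n))) \<le> 2 / sqrt 2 ^ n"
      using card_Omega_Int_le[OF elim, of "d n"] card_Omega0_ge by (intro frac_le) auto
    then show ?case by (simp add: power_divide)
  qed
  show "(\<lambda>n. 2 * (1 / sqrt 2) ^ n) \<longlonglongrightarrow> 0"
    by (intro tendsto_mult_right_zero LIMSEQ_realpow_zero) auto
qed simp

lemma prob_P_Omega_Un_tendsto:
  assumes "\<And>n. n \<ge> 1 \<Longrightarrow> d n \<ge> 1"
    and "filterlim (\<lambda>n. real (d n) - log 2 (real n)) at_top sequentially"
  shows "(\<lambda>n. prob_P n (d n) (Omega0 n (d n) \<union> Omega1 n (d n))) \<longlonglongrightarrow> 1"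
proof (rule tendsto_sandwich[OF _ _ _ tendsto_const])
  show "(\<lambda>n. 1 - real (card (Hom_P n (d n) - (Omega0 n (d n) \<union> Omega1 n (d n))))
      / real (card (Omega0 n (d n)))) \<longlonglongrightarrow> 1"
    using tendsto_diff[OF tendsto_const card_Hom_P_minus_Omega_tendsto[OF assms], of 1] by simp
  show "\<forall>\<^sub>F n in sequentially. prob_P n (d n) (Omega0 n (d n) \<union> Omega1 n (d n)) \<le> 1"
    by (simp add: prob_P_def)
  have "1 - real (card (Hom_P n (d n) - (Omega0 n (d n) \<union> Omega1 n (d n)))) / real (card (Omega0 n (d n)))
      \<le> prob_P n (d n) (Omega0 n (d n) \<union> Omega1 n (d n))" for n
  proof -
    let ?H = "Hom_P n (d n)" and ?U = "Omega0 n (d n) \<union> Omega1 n (d n)"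
    \<comment> \<open>The complement of \<open>?U\<close> in the whole function space and
      \<open>?H - ?U\<close> agree on the support, so they have equal probability.\<close>
    have "set_pmf (pmf_of_set ?H) = ?H" by (simp add: Hom_P_nonempty finite_Hom_P)
    then have "prob_P n (d n) (?H - ?U) = 1 - prob_P n (d n) ?U"
      unfolding prob_P_def by (subst measure_pmf.prob_compl[symmetric])
        (auto intro!: measure_eq_AE AE_pmfI)
    then show ?thesis using prob_P_le_card_div_Omega0[of "?H - ?U" n "d n"] by simp
  qed
  then show "\<forall>\<^sub>F n in sequentially.
      1 - real (card (Hom_P n (d n) - (Omega0 n (d n) \<union> Omega1 n (d n)))) / real (card (Omega0 n (d n)))
      \<le> prob_P n (d n) (Omega0 n (d n) \<union> Omega1 n (d n))"
    by (intro always_eventually) blast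
qed

lemma prob_P_Omega_Int_tendsto:
  "(\<lambda>n. prob_P n (d n) (Omega0 n (d n) \<inter> Omega1 n (d n))) \<longlonglongrightarrow> 0"
proof (rule tendsto_sandwich[OF _ _ tendsto_const card_Omega_Int_tendsto[of d]])
  show "\<forall>\<^sub>F n in sequentially. 0 \<le> prob_P n (d n) (Omega0 n (d n) \<inter> Omega1 n (d n))"
    by (simp add: prob_P_def)
  show "\<forall>\<^sub>F n in sequentially. prob_P n (d n) (Omega0 n (d n) \<inter> Omega1 n (d n))
      \<le> real (card (Omega0 n (d n) \<inter> Omega1 n (d n))) / real (card (Omega0 n (d n)))"
    using Omega_subset by (intro always_eventually allI prob_P_le_card_div_Omega0) blast
qed

text \<open>Along S the ratio of \<open>Omega1\<close> to \<open>Omega0\<close> is exactly r, so the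
  probability is 1/(1 + r + error) with a vanishing error. The values r = 1 for odd n and r = 2 for
  even n give 1/2 and 1/3.\<close>

lemma prob_P_Omega0_tendsto:
  assumes d: "\<And>n. n \<ge> 1 \<Longrightarrow> d n \<ge> 1"
      "filterlim (\<lambda>n. real (d n) - log 2 (real n)) at_top sequentially"
    and r: "r \<ge> 0"
    and S: "\<And>n. n \<ge> 1 \<Longrightarrow> n \<in> S \<Longrightarrow> real (card (Omega1 n (d n))) = r * real (card (Omega0 n (d n)))"
  shows "((\<lambda>n. prob_P n (d n) (Omega0 n (d n))) \<longlongrightarrow> 1 / (1 + r)) (inf sequentially (principal S))"
proof -
  define \<delta> where "\<delta> n = real (card (Hom_P n (d n) - (Omega0 n (d n) \<union> Omega1 n (d n))))
      / real (card (Omega0 n (d n)))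
    - real (card (Omega0 n (d n) \<inter> Omega1 n (d n))) / real (card (Omega0 n (d n)))" for n
  have "\<delta> \<longlonglongrightarrow> 0"
    unfolding \<delta>_def using tendsto_diff[OF card_Hom_P_minus_Omega_tendsto[OF d] card_Omega_Int_tendsto[of d]]
    by simp
  then have "((\<lambda>n. 1 / (1 + r + \<delta> n)) \<longlongrightarrow> 1 / (1 + r + 0)) (inf sequentially (principal S))"
    using r by (intro tendsto_intros tendsto_mono[OF inf_le1]) auto
  moreover have "\<forall>\<^sub>F n in inf sequentially (principal S).
      1 / (1 + r + \<delta> n) = prob_P n (d n) (Omega0 n (d n))"
    unfolding eventually_inf_principal using eventually_ge_at_top[of 1]
  proof eventually_elim
    case (elim n)
    then show ?case
      using S[of n] card_Omega0_pos[of n "d n"] by (simp add: prob_P_Omega0_eq \<delta>_def)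
  qed
  ultimately show ?thesis by (simp add: Lim_transform_eventually)
qed

lemma card_Omega1_odd:
  assumes "n \<ge> 1" "odd n"
  shows "card (Omega1 n d) = card (Omega0 n d)"
  using assms by (auto simp: card_Omega0 card_Omega1 elim!: oddE)

lemma card_Omega1_even:
  assumes "n \<ge> 1" "even n"
  shows "card (Omega1 n d) = 2 * card (Omega0 n d)"
  using assms by (auto simp: card_Omega0 card_Omega1 elim!: evenE)

lemma Rng_card_le_3_eq:
  assumes "n \<ge> 1"
  shows "{f \<in> Hom_P n d. card (Rng n f) \<le> 3} = Omega0 n d \<union> Omega1 n d"
  using Omega_Un_iff_card_Rng[OF assms] Omega_subset[of n d] by blast

lemma Rng_card_less_3_eq:
  assumes "n \<ge> 1"
  shows "{f \<in> Hom_P n d. card (Rng n f) < 3} = Omega0 n d \<inter> Omega1 n d"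
  using Omega_Int_iff_card_Rng[OF assms] Omega_subset[of n d] by blast

theorem corollary2p2:
  fixes d :: "nat \<Rightarrow> nat"
  assumes d_pos: "\<And>n. n \<ge> 1 \<Longrightarrow> d n \<ge> 1"
    and d_lim: "filterlim (\<lambda>n. real (d n) - log 2 (real n)) at_top sequentially"
  shows "(\<forall>n\<ge>1. prob_P n (d n) (Omega0 n (d n) \<union> Omega1 n (d n)) =
            prob_P n (d n) {f \<in> Hom_P n (d n). card (Rng n f) \<le> 3})
    \<and> (\<lambda>n. prob_P n (d n) {f \<in> Hom_P n (d n). card (Rng n f) \<le> 3}) \<longlonglongrightarrow> 1
    \<and> (\<forall>n\<ge>1. prob_P n (d n) (Omega0 n (d n) \<inter> Omega1 n (d n)) =
            prob_P n (d n) {f \<in> Hom_P n (d n). card (Rng n f) < 3})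
    \<and> (\<lambda>n. prob_P n (d n) {f \<in> Hom_P n (d n). card (Rng n f) < 3}) \<longlonglongrightarrow> 0
    \<and> ((\<lambda>n. prob_P n (d n) (Omega0 n (d n))) \<longlongrightarrow> 1 / 2)
         (inf sequentially (principal {n. odd n}))
    \<and> ((\<lambda>n. prob_P n (d n) (Omega0 n (d n))) \<longlongrightarrow> 1 / 3)
         (inf sequentially (principal {n. even n}))"
proof (intro conjI)
  show "\<forall>n\<ge>1. prob_P n (d n) (Omega0 n (d n) \<union> Omega1 n (d n)) =
      prob_P n (d n) {f \<in> Hom_P n (d n). card (Rng n f) \<le> 3}"
    by (simp add: Rng_card_le_3_eq)
  show "\<forall>n\<ge>1. prob_P n (d n) (Omega0 n (d n) \<inter> Omega1 n (d n)) =
      prob_P n (d n) {f \<in> Hom_P n (d n). card (Rng n f) < 3}"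
    by (simp add: Rng_card_less_3_eq)
  show "(\<lambda>n. prob_P n (d n) {f \<in> Hom_P n (d n). card (Rng n f) \<le> 3}) \<longlonglongrightarrow> 1"
    by (rule Lim_transform_eventually[OF prob_P_Omega_Un_tendsto[OF assms] eventually_sequentiallyI[of 1]])
      (simp_all add: Rng_card_le_3_eq)
  show "(\<lambda>n. prob_P n (d n) {f \<in> Hom_P n (d n). card (Rng n f) < 3}) \<longlonglongrightarrow> 0"
    by (rule Lim_transform_eventually[OF prob_P_Omega_Int_tendsto eventually_sequentiallyI[of 1]])
      (simp_all add: Rng_card_less_3_eq)
  show "((\<lambda>n. prob_P n (d n) (Omega0 n (d n))) \<longlongrightarrow> 1 / 2)
      (inf sequentially (principal {n. odd n}))"
    using prob_P_Omega0_tendsto[OF assms, of 1 "{n. odd n}"] by (simp add: card_Omega1_odd)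
  show "((\<lambda>n. prob_P n (d n) (Omega0 n (d n))) \<longlongrightarrow> 1 / 3)
      (inf sequentially (principal {n. even n}))"
    using prob_P_Omega0_tendsto[OF assms, of 2 "{n. even n}"] by (simp add: card_Omega1_even)
qed

end
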